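(* Let $p$ be a prime and let $\Psi$ be a system of $t$ linear forms over $\mathbb{F}_p$ whose image is described by two linear equations (i.e. $\operatorname{Im}\Psi=\ker M$ for a $2\times t$ matrix $M$ of rank two), and suppose $\Psi$ is linearly generic. If $t$ is even, or if $\Psi$ does not contain an additive tuple and $p$ is sufficiently large in terms of $t$, then $\Psi$ is not weakly locally Sidorenko.
   Context: A system of linear forms $\Psi=(\psi_1,\ldots,\psi_t)$ consists of $\mathbb{F}_p$-linear maps $\psi_i:\mathbb{F}_p^D\to\mathbb{F}_p$ (with $D\le t$ and $x\mapsto(\psi_1(x),\ldots,\psi_t(x))$ injective), also acting $(\mathbb{F}_p^n)^D\to\mathbb{F}_p^n$ by the same formula. Its image is $\operatorname{Im}\Psi=\{(\psi_i(x))_{i=1}^t:x\in\mathbb{F}_p^D\}\le\mathbb{F}_p^t$; for $S\subseteq[t]$, $\Psi(S)=(\psi_i)_{i\in S}$. For $f:\mathbb{F}_p^n\to\mathbb{C}$, $T_\Psi(f)=p^{-nD}\sum_{x\in(\mathbb{F}_p^n)^D}\prod_{i=1}^tf(\psi_i(x))$. $\Psi$ is weakly locally Sidorenko if for all $n\ge1$, all $\alpha\in[0,1]$ and all $f:\mathbb{F}_p^n\to[-\alpha,1-\alpha]$ with $\mathbb{E}_xf(x)=0$ there is $\varepsilon_f>0$ such that $T_\Psi(\alpha+\varepsilon f)\ge\alpha^t$ for all $0<\varepsilon<\varepsilon_f$. $\Psi$ is linearly generic if every $2\times2$ minor of $M$ has nonzero determinant. $\Psi$ contains an additive tuple if for some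 $k$ there is $S\subseteq[t]$, $|S|=k$, such that after reordering the indices of $S$, $\operatorname{Im}\Psi(S)=\{y\in\mathbb{F}_p^k:y_1-y_2+\cdots+(-1)^{k+1}y_k=0\}$. *)

theory Defs
  imports Complex_Main "HOL-Library.FuncSet" "HOL-Number_Theory.Cong"
begin

text \<open>
  The main theorem needs a lower bound on \<open>p\<close> that depends only on \<open>t\<close>, so \<open>p\<close> has to be a
  number that can be quantified over, and \<open>\<bbbF>\<^sub>p\<close> cannot be a type. It is rendered by the canonical
  residues \<open>{0..<p}\<close> with integer arithmetic modulo \<open>p\<close>. Vectors are functions that are
  \<^const>\<open>undefined\<close> outside the index set, so that sets of vectors have the right cardinality.
  Indices start at \<open>0\<close>.
\<close>

definition Fp :: "nat \<Rightarrow> int set" where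
  "Fp p = {0..<int p}"

definition Fp_vec :: "nat \<Rightarrow> nat \<Rightarrow> (nat \<Rightarrow> int) set" where
  "Fp_vec p n = ({..<n} \<rightarrow>\<^sub>E Fp p)"

text \<open>
  A linear form on \<open>\<bbbF>\<^sub>p\<^sup>D\<close> is given by its coefficients \<open>a 0, \<dots>, a (D - 1)\<close>. These may be
  arbitrary integers; only their residues modulo \<open>p\<close> matter. The same applies to the entries of
  matrices below.
\<close>

definition form :: "nat \<Rightarrow> nat \<Rightarrow> (nat \<Rightarrow> int) \<Rightarrow> (nat \<Rightarrow> int) \<Rightarrow> int" where
  "form p D a x = (\<Sum>j<D. a j * x j) mod int p"

text \<open>
  The action \<open>(\<bbbF>\<^sub>p\<^sup>n)\<^sup>D \<rightarrow> \<bbbF>\<^sub>p\<^sup>n\<close> of the same form: here \<open>x j\<close> is the \<open>j\<close>-th vector and \<open>x j k\<close> its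
  \<open>k\<close>-th coordinate.
\<close>

definition form_vec ::
  "nat \<Rightarrow> nat \<Rightarrow> nat \<Rightarrow> (nat \<Rightarrow> int) \<Rightarrow> (nat \<Rightarrow> nat \<Rightarrow> int) \<Rightarrow> (nat \<Rightarrow> int)" where
  "form_vec p n D a x = (\<lambda>k\<in>{..<n}. (\<Sum>j<D. a j * x j k) mod int p)"

definition eval_forms ::
  "nat \<Rightarrow> nat \<Rightarrow> nat \<Rightarrow> (nat \<Rightarrow> nat \<Rightarrow> int) \<Rightarrow> (nat \<Rightarrow> int) \<Rightarrow> (nat \<Rightarrow> int)" where
  "eval_forms p D t \<Psi> x = (\<lambda>i\<in>{..<t}. form p D (\<Psi> i) x)"

definition linear_system :: "nat \<Rightarrow> nat \<Rightarrow> nat \<Rightarrow> (nat \<Rightarrow> nat \<Rightarrow> int) \<Rightarrow> bool" where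
  "linear_system p D t \<Psi> \<longleftrightarrow> D \<le> t \<and> inj_on (eval_forms p D t \<Psi>) (Fp_vec p D)"

definition Im_forms :: "nat \<Rightarrow> nat \<Rightarrow> nat \<Rightarrow> (nat \<Rightarrow> nat \<Rightarrow> int) \<Rightarrow> (nat \<Rightarrow> int) set" where
  "Im_forms p D t \<Psi> = eval_forms p D t \<Psi> ` Fp_vec p D"

definition T_forms ::
  "nat \<Rightarrow> nat \<Rightarrow> nat \<Rightarrow> nat \<Rightarrow> (nat \<Rightarrow> nat \<Rightarrow> int) \<Rightarrow> ((nat \<Rightarrow> int) \<Rightarrow> 'a::field_char_0) \<Rightarrow> 'a" where
  "T_forms p n D t \<Psi> f =
     (\<Sum>x\<in>{..<D} \<rightarrow>\<^sub>E Fp_vec p n. \<Prod>i<t. f (form_vec p n D (\<Psi> i) x)) / of_nat p ^ (n * D)"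

definition weakly_locally_Sidorenko :: "nat \<Rightarrow> nat \<Rightarrow> nat \<Rightarrow> (nat \<Rightarrow> nat \<Rightarrow> int) \<Rightarrow> bool" where
  "weakly_locally_Sidorenko p D t \<Psi> \<longleftrightarrow>
     (\<forall>n\<ge>1. \<forall>\<alpha>\<in>{0..1}. \<forall>f :: (nat \<Rightarrow> int) \<Rightarrow> real.
        (\<forall>x\<in>Fp_vec p n. f x \<in> {-\<alpha>..1 - \<alpha>}) \<longrightarrow>
        (\<Sum>x\<in>Fp_vec p n. f x) / real p ^ n = 0 \<longrightarrow>
        (\<exists>\<epsilon>\<^sub>f>0. \<forall>\<epsilon>. 0 < \<epsilon> \<and> \<epsilon> < \<epsilon>\<^sub>f \<longrightarrow>
           T_forms p n D t \<Psi> (\<lambda>x. \<alpha> + \<epsilon> * f x) \<ge> \<alpha> ^ t))"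

definition ker_mod :: "nat \<Rightarrow> nat \<Rightarrow> nat \<Rightarrow> (nat \<Rightarrow> nat \<Rightarrow> int) \<Rightarrow> (nat \<Rightarrow> int) set" where
  "ker_mod p m t M = {y \<in> Fp_vec p t. \<forall>r<m. [(\<Sum>j<t. M r j * y j) = 0] (mod int p)}"

text \<open>The rank over \<open>\<bbbF>\<^sub>p\<close> as the largest number of linearly independent rows.\<close>

definition rank_mod :: "nat \<Rightarrow> nat \<Rightarrow> nat \<Rightarrow> (nat \<Rightarrow> nat \<Rightarrow> int) \<Rightarrow> nat" where
  "rank_mod p m t M =
     Max {card I | I. I \<subseteq> {..<m} \<and>
       (\<forall>c :: nat \<Rightarrow> int. (\<forall>j<t. [(\<Sum>r\<in>I. c r * M r j) = 0] (mod int p)) \<longrightarrow>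
          (\<forall>r\<in>I. [c r = 0] (mod int p)))}"

text \<open>
  Genericity is stated for the matrix \<open>M\<close> of a description \<open>Im \<Psi> = ker M\<close>. Changing \<open>M\<close> multiplies
  all minors by one nonzero scalar, so this is a property of \<open>\<Psi>\<close>.
\<close>

definition linearly_generic :: "nat \<Rightarrow> nat \<Rightarrow> (nat \<Rightarrow> nat \<Rightarrow> int) \<Rightarrow> bool" where
  "linearly_generic p t M \<longleftrightarrow>
     (\<forall>i j. i < j \<and> j < t \<longrightarrow> \<not> [M 0 i * M 1 j - M 0 j * M 1 i = 0] (mod int p))"

text \<open>
  The bijection \<open>\<sigma>\<close> is the reordering of \<open>S\<close>. The condition \<open>k \<ge> 1\<close> is needed: for \<open>k = 0\<close> the
  required equation of images holds for every system.
\<close>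

definition contains_additive_tuple :: "nat \<Rightarrow> nat \<Rightarrow> nat \<Rightarrow> (nat \<Rightarrow> nat \<Rightarrow> int) \<Rightarrow> bool" where
  "contains_additive_tuple p D t \<Psi> \<longleftrightarrow>
     (\<exists>k\<ge>1. \<exists>S\<subseteq>{..<t}. card S = k \<and>
        (\<exists>\<sigma>. bij_betw \<sigma> {..<k} S \<and>
           Im_forms p D k (\<Psi> \<circ> \<sigma>) =
             {y \<in> Fp_vec p k. [(\<Sum>i<k. (- 1) ^ i * y i) = 0] (mod int p)}))"

end

theory Submission
  imports Defs "HOL-Library.Real_Mod" "HOL-Library.Product_Plus"
begin

text \<open>
  Perturb a constant \<open>\<alpha>\<close> by a real trigonometric polynomial \<open>\<eta> \<Sum> w b e(b \<cdot> y / p)\<close> on \<open>\<bbbF>\<^sub>p\<^sup>2\<close> without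
  constant term. Its density is a sum over resonances: families \<open>b 0, \<dots>, b (t - 1)\<close> of frequencies
  annihilating \<open>Im \<Psi>\<close>, where a vanishing \<open>b i\<close> stands for a factor \<open>\<alpha>\<close>. By genericity a resonance with
  two zeros vanishes, so the density is \<open>\<alpha>\<^sup>t + \<alpha> \<eta>\<^bsup>t-1\<^esup> X + \<eta>\<^sup>t Y\<close>, where \<open>X\<close> collects the resonances with one
  zero and \<open>Y\<close> those without zeros. It remains to get \<open>X < 0\<close>, or \<open>X = 0\<close> and \<open>Y < 0\<close>.

  For even \<open>t\<close> take weight \<open>-1\<close> on all nonzero multiples of one direction: every term of \<open>X\<close> is
  \<open>(-1)\<^bsup>t-1\<^esup> = -1\<close>. For odd \<open>t\<close>, suppose first that some resonance with one zero has all other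
  entries \<open>\<plusminus>1\<close> in one direction. Without additive tuples the signs in such resonances never balance, so
  giving the frequencies \<open>\<plusminus>1\<close> the phases \<open>\<plusminus>\<theta>\<close> makes \<open>X\<close> average to zero over \<open>\<theta>\<close> without vanishing.
  Otherwise put weight \<open>-1\<close> on the columns of \<open>M\<close> and their negatives: they lie on distinct lines, which
  forces \<open>X = 0\<close>, while the columns themselves form a resonance and every term of \<open>Y\<close> is \<open>(-1)\<^sup>t = -1\<close>.
\<close>

subsection \<open>Additive characters\<close>

text \<open>The modulus is a parameter because the characters serve twice: modulo \<open>p\<close>
  as the Fourier basis, and modulo \<open>t\<close> as phases of weights to be averaged.\<close>

definition unit_char :: "nat \<Rightarrow> int \<Rightarrow> complex" where
  "unit_char N m = cis (2 * pi * of_int m / of_nat N)"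

lemma unit_char_0 [simp]: "unit_char N 0 = 1"
  by (simp add: unit_char_def)

lemma unit_char_add: "unit_char N (m + n) = unit_char N m * unit_char N n"
  by (simp add: unit_char_def cis_mult add_divide_distrib distrib_left)

lemma unit_char_sum: "unit_char N (\<Sum>i\<in>I. m i) = (\<Prod>i\<in>I. unit_char N (m i))"
  by (induction I rule: infinite_finite_induct) (simp_all add: unit_char_add)

lemma cnj_unit_char: "cnj (unit_char N m) = unit_char N (- m)"
  by (simp add: unit_char_def cis_cnj)

lemma unit_char_power: "unit_char N m ^ k = unit_char N (m * int k)"
  by (simp add: unit_char_def Complex.DeMoivre mult_ac)

lemma norm_unit_char [simp]: "norm (unit_char N m) = 1"
  by (simp add: unit_char_def)

lemma unit_char_eq_1_iff:
  assumes "N > 0"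
  shows "unit_char N m = 1 \<longleftrightarrow> int N dvd m"
proof -
  have "unit_char N m = 1 \<longleftrightarrow> (\<exists>k. of_int m = (of_int (int N * k) :: real))"
    using assms by (simp add: unit_char_def cis_eq_1_iff field_simps)
  then show ?thesis
    unfolding of_int_eq_iff dvd_def .
qed

lemma unit_char_cong:
  assumes "N > 0" "[m = n] (mod int N)"
  shows "unit_char N m = unit_char N n"
proof -
  have "unit_char N (m - n) = 1"
    using assms by (simp add: unit_char_eq_1_iff cong_iff_dvd_diff)
  then show ?thesis
    using unit_char_add[of N "m - n" n] by simp
qed

lemma sum_unit_char:
  assumes "N > 0"
  shows "(\<Sum>r\<in>Fp N. unit_char N (m * r)) = (if int N dvd m then of_nat N else 0)"
proof -
  have "(\<Sum>r\<in>Fp N. unit_char N (m * r)) = (\<Sum>k<N. unit_char N m ^ k)"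
    by (rule sum.reindex_bij_witness[of _ int nat]) (auto simp: Fp_def unit_char_power)
  also have "\<dots> = (if int N dvd m then of_nat N else 0)"
  proof (cases "int N dvd m")
    case True
    then have "unit_char N m = 1"
      using assms by (simp add: unit_char_eq_1_iff)
    with True show ?thesis
      by simp
  next
    case False
    then have "unit_char N m \<noteq> 1"
      using assms by (simp add: unit_char_eq_1_iff)
    moreover have "unit_char N m ^ N = 1"
      using assms by (simp add: unit_char_power unit_char_eq_1_iff)
    ultimately show ?thesis
      using False by (simp add: sum_gp_strict geometric_sum)
  qed
  finally show ?thesis .
qed

lemma finite_Fp_vec [simp]: "finite (Fp_vec p n)"
  by (simp add: Fp_vec_def Fp_def finite_PiE)

text \<open>Orthogonality of characters, one coordinate at a time. The dimension is 2 because the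
  columns of \<open>M\<close> will serve as frequencies.\<close>

lemma sum_unit_char_vec:
  assumes "p > 0"
  shows "(\<Sum>v\<in>Fp_vec p 2. unit_char p (c * v 0 + d * v 1)) =
    (if int p dvd c \<and> int p dvd d then of_nat p ^ 2 else 0)"
proof -
  have "(\<Sum>v\<in>Fp_vec p 2. unit_char p (c * v 0 + d * v 1)) =
      (\<Sum>v\<in>Fp_vec p 2. \<Prod>k<2. unit_char p ((if k = 0 then c else d) * v k))"
    by (simp add: unit_char_add numeral_2_eq_2)
  also have "\<dots> = (\<Prod>k<2. \<Sum>r\<in>Fp p. unit_char p ((if k = (0::nat) then c else d) * r))"
    unfolding Fp_vec_def by (subst prod_sum_PiE) (simp_all add: Fp_def)
  also have "\<dots> = (if int p dvd c \<and> int p dvd d then of_nat p ^ 2 else 0)"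
    using assms by (simp add: sum_unit_char numeral_2_eq_2)
  finally show ?thesis .
qed

subsection \<open>Expansion of the density over resonances\<close>

text \<open>Frequencies are pairs of integers standing for their residues, so \<open>B\<close> may contain several
  representatives of one frequency.\<close>

definition trig_poly :: "nat \<Rightarrow> (int \<times> int) set \<Rightarrow> (int \<times> int \<Rightarrow> complex) \<Rightarrow> (nat \<Rightarrow> int) \<Rightarrow> complex" where
  "trig_poly p B w y = (\<Sum>b\<in>B. w b * unit_char p (fst b * y 0 + snd b * y 1))"

text \<open>This is orthogonality of \<open>g\<close> to the image modulo \<open>p\<close>, written
  with the coefficients that come out of the Fourier expansion; \<open>annihilates_iff\<close>
  translates it to the kernel of \<open>M\<close>.\<close>

definition annihilates :: "nat \<Rightarrow> nat \<Rightarrow> nat \<Rightarrow> (nat \<Rightarrow> nat \<Rightarrow> int) \<Rightarrow> (nat \<Rightarrow> int) \<Rightarrow> bool" where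
  "annihilates p D t \<Psi> g \<longleftrightarrow> (\<forall>j<D. int p dvd (\<Sum>i<t. g i * \<Psi> i j))"

definition resonances ::
  "nat \<Rightarrow> nat \<Rightarrow> nat \<Rightarrow> (nat \<Rightarrow> nat \<Rightarrow> int) \<Rightarrow> (int \<times> int) set \<Rightarrow> (nat \<Rightarrow> int \<times> int) set" where
  "resonances p D t \<Psi> B = {b \<in> {..<t} \<rightarrow>\<^sub>E B.
     annihilates p D t \<Psi> (\<lambda>i. fst (b i)) \<and> annihilates p D t \<Psi> (\<lambda>i. snd (b i))}"

lemma finite_resonances: "finite B \<Longrightarrow> finite (resonances p D t \<Psi> B)"
  by (simp add: resonances_def finite_PiE)

text \<open>Expanding the product gives one term per choice \<open>b\<close> of frequencies.
  Regrouped by variables, each term is a product of complete character sums, which vanishes unless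
  the coefficients of all \<open>x j\<close> are divisible by \<open>p\<close>, that is, unless
  \<open>b\<close> is a resonance.\<close>

lemma T_forms_trig_poly:
  assumes "p > 0" "finite B"
  shows "T_forms p 2 D t \<Psi> (trig_poly p B w) = (\<Sum>b\<in>resonances p D t \<Psi> B. \<Prod>i<t. w (b i))"
proof -
  define P where "P = {..<t} \<rightarrow>\<^sub>E B"
  define X where "X = {..<D} \<rightarrow>\<^sub>E Fp_vec p 2"
  define C where "C b j = (\<Sum>i<t. fst (b i) * \<Psi> i j)" for b :: "nat \<Rightarrow> int \<times> int" and j
  define C' where "C' b j = (\<Sum>i<t. snd (b i) * \<Psi> i j)" for b :: "nat \<Rightarrow> int \<times> int" and j
  \<comment> \<open>The reduction modulo \<open>p\<close> inside \<open>form_vec\<close> is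
    invisible to the characters, so the double sum in the exponent may be regrouped by
    \<open>j\<close>.\<close>
  have char: "(\<Prod>i<t. unit_char p (fst (b i) * form_vec p 2 D (\<Psi> i) x 0 +
        snd (b i) * form_vec p 2 D (\<Psi> i) x 1)) =
      (\<Prod>j<D. unit_char p (C b j * x j 0 + C' b j * x j 1))" for b x
  proof -
    have "(\<Prod>i<t. unit_char p (fst (b i) * form_vec p 2 D (\<Psi> i) x 0 +
        snd (b i) * form_vec p 2 D (\<Psi> i) x 1)) =
      (\<Prod>i<t. unit_char p (fst (b i) * (\<Sum>j<D. \<Psi> i j * x j 0) +
        snd (b i) * (\<Sum>j<D. \<Psi> i j * x j 1)))"
      using assms(1)
      by (intro prod.cong refl unit_char_cong cong_add cong_mult cong_refl)
        (simp_all add: form_vec_def)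
    also have "\<dots> = unit_char p (\<Sum>i<t. \<Sum>j<D. fst (b i) * \<Psi> i j * x j 0 + snd (b i) * \<Psi> i j * x j 1)"
      by (simp add: unit_char_sum[symmetric] sum_distrib_left sum.distrib mult.assoc)
    also have "(\<Sum>i<t. \<Sum>j<D. fst (b i) * \<Psi> i j * x j 0 + snd (b i) * \<Psi> i j * x j 1) =
        (\<Sum>j<D. C b j * x j 0 + C' b j * x j 1)"
      by (subst sum.swap) (simp add: C_def C'_def sum_distrib_right sum.distrib)
    finally show ?thesis
      by (simp add: unit_char_sum)
  qed
  have "(\<Sum>x\<in>X. \<Prod>i<t. trig_poly p B w (form_vec p 2 D (\<Psi> i) x)) =
      (\<Sum>x\<in>X. \<Sum>b\<in>P. \<Prod>i<t. w (b i) * unit_char p (fst (b i) * form_vec p 2 D (\<Psi> i) x 0 +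
        snd (b i) * form_vec p 2 D (\<Psi> i) x 1))"
    unfolding trig_poly_def P_def using assms(2) by (subst prod_sum_PiE) simp_all
  also have "\<dots> = (\<Sum>b\<in>P. \<Sum>x\<in>X. (\<Prod>i<t. w (b i)) *
      (\<Prod>j<D. unit_char p (C b j * x j 0 + C' b j * x j 1)))"
    by (subst sum.swap) (simp only: prod.distrib char)
  also have "\<dots> = (\<Sum>b\<in>P. (\<Prod>i<t. w (b i)) *
      (\<Prod>j<D. \<Sum>v\<in>Fp_vec p 2. unit_char p (C b j * v 0 + C' b j * v 1)))"
    unfolding X_def by (simp add: sum_distrib_left prod_sum_PiE)
  also have "\<dots> = (\<Sum>b\<in>P. if b \<in> resonances p D t \<Psi> B
      then of_nat p ^ (2 * D) * (\<Prod>i<t. w (b i)) else 0)"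
  proof (rule sum.cong[OF refl])
    fix b assume "b \<in> P"
    have "(\<Prod>j<D. \<Sum>v\<in>Fp_vec p 2. unit_char p (C b j * v 0 + C' b j * v 1)) =
        (\<Prod>j<D. if int p dvd C b j \<and> int p dvd C' b j then of_nat p ^ 2 else 0)"
      using assms(1) by (simp only: sum_unit_char_vec)
    also have "\<dots> = (if b \<in> resonances p D t \<Psi> B then of_nat p ^ (2 * D) else 0)"
    proof (cases "b \<in> resonances p D t \<Psi> B")
      case True
      then have "int p dvd C b j" "int p dvd C' b j" if "j < D" for j
        using that by (auto simp: resonances_def annihilates_def C_def C'_def)
      with True show ?thesis
        by (simp add: power_mult)
    next
      case False
      then obtain j where "j < D" "\<not> (int p dvd C b j \<and> int p dvd C' b j)"
        using \<open>b \<in> P\<close> by (auto simp: P_def resonances_def annihilates_def C_def C'_def)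
      with False show ?thesis
        by (auto intro!: prod_zero)
    qed
    finally show "(\<Prod>i<t. w (b i)) *
        (\<Prod>j<D. \<Sum>v\<in>Fp_vec p 2. unit_char p (C b j * v 0 + C' b j * v 1)) =
      (if b \<in> resonances p D t \<Psi> B then of_nat p ^ (2 * D) * (\<Prod>i<t. w (b i)) else 0)"
      by simp
  qed
  also have "\<dots> = of_nat p ^ (2 * D) * (\<Sum>b\<in>resonances p D t \<Psi> B. \<Prod>i<t. w (b i))"
  proof -
    have "finite P" "P \<inter> resonances p D t \<Psi> B = resonances p D t \<Psi> B"
      using assms(2) by (auto simp: P_def resonances_def intro: finite_PiE)
    then show ?thesis
      by (simp add: sum.inter_restrict[symmetric] sum_distrib_left)
  qed
  finally show ?thesis
    using assms(1) by (simp add: T_forms_def X_def)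
qed

lemma of_real_T_forms:
  "complex_of_real (T_forms p n D t \<Psi> f) = T_forms p n D t \<Psi> (\<lambda>x. complex_of_real (f x))"
  by (simp add: T_forms_def)

text \<open>Zero means the literal pair here. This agrees with zero modulo \<open>p\<close> whenever
  \<open>B\<close> contains no pair divisible by \<open>p\<close>.\<close>

definition num_zeros :: "nat \<Rightarrow> (nat \<Rightarrow> int \<times> int) \<Rightarrow> nat" where
  "num_zeros t b = card {i. i < t \<and> b i = 0}"

text \<open>Up to powers of \<alpha> and \<eta>, this is the part of the density with exactly
  \<open>m\<close> factors \<alpha>. Frequency 0 stands for the constant term, so
  \<open>w 0 = 1\<close> is the neutral convention.\<close>

definition resonance_sum ::
  "nat \<Rightarrow> nat \<Rightarrow> nat \<Rightarrow> (nat \<Rightarrow> nat \<Rightarrow> int) \<Rightarrow> (int \<times> int) set \<Rightarrow> (int \<times> int \<Rightarrow> complex) \<Rightarrow> nat \<Rightarrow> complex"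
where
  "resonance_sum p D t \<Psi> B w m =
     (\<Sum>b\<in>{b \<in> resonances p D t \<Psi> (insert 0 B). num_zeros t b = m}. \<Prod>i<t. w (b i))"

text \<open>A resonance with \<open>m\<close> zeros contributes
  \<open>\<alpha> ^ m * \<eta> ^ (t - m)\<close> times its weights. By \<open>two\<close>, only
  \<open>m = 0\<close>, \<open>m = 1\<close> and the zero resonance occur.\<close>

lemma T_forms_constant_plus_trig_poly:
  fixes \<alpha> \<eta> :: complex
  assumes p: "p > 0" and B: "finite B" "0 \<notin> B" and t: "t \<ge> 2" and w0: "w 0 = 1"
    and two: "\<And>b i j l. b \<in> resonances p D t \<Psi> (insert 0 B) \<Longrightarrow> i < t \<Longrightarrow> j < t \<Longrightarrow> i \<noteq> j \<Longrightarrow>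
      b i = 0 \<Longrightarrow> b j = 0 \<Longrightarrow> l < t \<Longrightarrow> b l = 0"
  shows "T_forms p 2 D t \<Psi> (\<lambda>y. \<alpha> + \<eta> * trig_poly p B w y) =
    \<alpha> ^ t + \<alpha> * \<eta> ^ (t - 1) * resonance_sum p D t \<Psi> B w 1 + \<eta> ^ t * resonance_sum p D t \<Psi> B w 0"
proof -
  \<comment> \<open>The constant is absorbed as the weight of frequency 0, so that the whole
    function is a single trigonometric polynomial.\<close>
  define w' where "w' b = (if b = 0 then \<alpha> else \<eta>) * w b" for b
  define R where "R = resonances p D t \<Psi> (insert 0 B)"
  define R0 where "R0 = {b \<in> R. num_zeros t b = 0}"
  define R1 where "R1 = {b \<in> R. num_zeros t b = 1}"
  define z :: "nat \<Rightarrow> int \<times> int" where "z = (\<lambda>i\<in>{..<t}. 0)"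
  define F where "F b = (\<Prod>i<t. w' (b i))" for b :: "nat \<Rightarrow> int \<times> int"
  have "(\<lambda>y. \<alpha> + \<eta> * trig_poly p B w y) = trig_poly p (insert 0 B) w'"
  proof
    fix y :: "nat \<Rightarrow> int"
    have "(\<Sum>b\<in>B. w' b * unit_char p (fst b * y 0 + snd b * y 1)) =
        (\<Sum>b\<in>B. \<eta> * w b * unit_char p (fst b * y 0 + snd b * y 1))"
      using B(2) by (intro sum.cong) (auto simp: w'_def)
    then show "\<alpha> + \<eta> * trig_poly p B w y = trig_poly p (insert 0 B) w' y"
      using B w0 by (simp add: trig_poly_def w'_def sum_distrib_left mult.assoc)
  qed
  then have "T_forms p 2 D t \<Psi> (\<lambda>y. \<alpha> + \<eta> * trig_poly p B w y) = sum F R"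
    using T_forms_trig_poly[OF p] B(1) by (simp add: R_def F_def)
  also have "R = insert z (R1 \<union> R0)"
  proof -
    have "z \<in> R"
      by (auto simp: R_def z_def resonances_def annihilates_def)
    moreover have "b = z" if b: "b \<in> R" "num_zeros t b \<noteq> 0" "num_zeros t b \<noteq> 1" for b
    proof -
      have "card {i. i < t \<and> b i = 0} \<ge> 2"
        using b(2,3) unfolding num_zeros_def by linarith
      then obtain i j where "i < t" "j < t" "i \<noteq> j" "b i = 0" "b j = 0"
        by (auto simp: card_le_Suc_iff numeral_2_eq_2)
      then have "b l = 0" if "l < t" for l
        using two b(1) that unfolding R_def by blast
      moreover have "b l = undefined" if "\<not> l < t" for l
        using b(1) that by (auto simp: R_def resonances_def PiE_def extensional_def)
      ultimately show ?thesis
        by (auto simp: z_def)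
    qed
    ultimately show ?thesis
      by (auto simp: R0_def R1_def)
  qed
  also have "sum F (insert z (R1 \<union> R0)) = F z + (sum F R1 + sum F R0)"
  proof -
    \<comment> \<open>The zero resonance has \<open>t\<close> zeros, and \<open>t >= 2\<close> keeps
      it apart from the resonances with at most one.\<close>
    have "num_zeros t z = card {..<t}"
      unfolding num_zeros_def by (rule arg_cong[of _ _ card]) (auto simp: z_def)
    then have "z \<notin> R1 \<union> R0"
      using t by (simp add: R0_def R1_def)
    moreover have "finite R0" "finite R1" "R1 \<inter> R0 = {}"
      using B(1) by (auto simp: R0_def R1_def R_def finite_resonances)
    ultimately show ?thesis
      by (simp add: sum.union_disjoint)
  qed
  also have "F z = \<alpha> ^ t"
    using w0 by (simp add: F_def z_def w'_def)
  finally have main: "T_forms p 2 D t \<Psi> (\<lambda>y. \<alpha> + \<eta> * trig_poly p B w y) =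
      \<alpha> ^ t + (sum F R1 + sum F R0)" .
  have F: "F b = \<alpha> ^ num_zeros t b * \<eta> ^ (t - num_zeros t b) * (\<Prod>i<t. w (b i))" for b
  proof -
    have "{..<t} \<inter> {i. b i = 0} = {i. i < t \<and> b i = 0}"
      "{..<t} \<inter> - {i. b i = 0} = {..<t} - {i. i < t \<and> b i = 0}"
      by auto
    moreover have "card ({..<t} - {i. i < t \<and> b i = 0}) = t - num_zeros t b"
      unfolding num_zeros_def by (subst card_Diff_subset) auto
    ultimately show ?thesis
      by (simp add: F_def w'_def prod.distrib prod.If_cases num_zeros_def)
  qed
  have "sum F R1 = \<alpha> * \<eta> ^ (t - 1) * resonance_sum p D t \<Psi> B w 1"
    by (simp add: F R1_def R_def resonance_sum_def sum_distrib_left)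
  moreover have "sum F R0 = \<eta> ^ t * resonance_sum p D t \<Psi> B w 0"
    by (simp add: F R0_def R_def resonance_sum_def sum_distrib_left)
  ultimately show ?thesis
    by (simp add: main)
qed

section \<open>From a negative resonance sum to a violation of the inequality\<close>

lemma sum_trig_poly_eq_0:
  assumes "p > 0" and "\<And>b. b \<in> B \<Longrightarrow> \<not> (int p dvd fst b \<and> int p dvd snd b)"
  shows "(\<Sum>v\<in>Fp_vec p 2. trig_poly p B w v) = 0"
proof -
  have "(\<Sum>v\<in>Fp_vec p 2. trig_poly p B w v) =
      (\<Sum>b\<in>B. w b * (\<Sum>v\<in>Fp_vec p 2. unit_char p (fst b * v 0 + snd b * v 1)))"
    unfolding trig_poly_def by (subst sum.swap) (simp add: sum_distrib_left)
  also have "\<dots> = 0"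
    using assms by (intro sum.neutral ballI) (simp only: sum_unit_char_vec if_False mult_zero_right)
  finally show ?thesis .
qed

lemma cnj_trig_poly:
  assumes "\<And>b. b \<in> B \<Longrightarrow> - b \<in> B" and "\<And>b. b \<in> B \<Longrightarrow> w (- b) = cnj (w b)"
  shows "cnj (trig_poly p B w y) = trig_poly p B w y"
  unfolding trig_poly_def cnj_sum
  using assms
  by (intro sum.reindex_bij_witness[of _ uminus uminus]) (auto simp: cnj_unit_char)

lemma norm_trig_poly_le: "norm (trig_poly p B w y) \<le> (\<Sum>b\<in>B. norm (w b))"
  unfolding trig_poly_def by (rule sum_norm_le) (simp add: norm_mult)

text \<open>At density 1/2 the deviation from \<open>(1/2) ^ t\<close> is
  \<open>\<eta> ^ (t - 1) * (X / 2 + \<eta> * Y)\<close>, which is negative for all small positive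
  \<eta>. The symmetry of \<open>B\<close> and \<open>w\<close> makes the perturbation real; the
  nonzero frequencies give it mean zero.\<close>

lemma not_weakly_locally_Sidorenko_if_resonance_sum_neg:
  assumes p: "p > 0" and B: "finite B" and t: "t \<ge> 2" and w0: "w 0 = 1"
    and sym: "\<And>b. b \<in> B \<Longrightarrow> - b \<in> B" "\<And>b. b \<in> B \<Longrightarrow> w (- b) = cnj (w b)"
    and nz: "\<And>b. b \<in> B \<Longrightarrow> \<not> (int p dvd fst b \<and> int p dvd snd b)"
    and two: "\<And>b i j l. b \<in> resonances p D t \<Psi> (insert 0 B) \<Longrightarrow> i < t \<Longrightarrow> j < t \<Longrightarrow> i \<noteq> j \<Longrightarrow>
      b i = 0 \<Longrightarrow> b j = 0 \<Longrightarrow> l < t \<Longrightarrow> b l = 0"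
    and neg: "Re (resonance_sum p D t \<Psi> B w 1) < 0 \<or>
      resonance_sum p D t \<Psi> B w 1 = 0 \<and> Re (resonance_sum p D t \<Psi> B w 0) < 0"
  shows "\<not> weakly_locally_Sidorenko p D t \<Psi>"
proof
  assume WLS: "weakly_locally_Sidorenko p D t \<Psi>"
  define X where "X = Re (resonance_sum p D t \<Psi> B w 1)"
  define Y where "Y = Re (resonance_sum p D t \<Psi> B w 0)"
  \<comment> \<open>A positive bound for the sup norm of the polynomial, so dividing by
    \<open>2 * c\<close> brings the values into the interval from -1/2 to 1/2.\<close>
  define c where "c = 1 + (\<Sum>b\<in>B. norm (w b))"
  define f where "f y = Re (trig_poly p B w y) / (2 * c)" for y
  have "0 \<notin> B"
    using nz[of 0] by auto
  have c: "c > 0"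
    by (simp add: c_def add_pos_nonneg sum_nonneg)
  have f: "complex_of_real (f y) = trig_poly p B w y / of_real (2 * c)" for y
  proof -
    have "trig_poly p B w y \<in> \<real>"
      using cnj_trig_poly[of B w, OF sym] by (simp add: Reals_cnj_iff)
    then show ?thesis
      by (simp add: f_def)
  qed
  have "f v \<in> {-(1/2)..1 - 1/2}" for v
  proof -
    have "\<bar>Re (trig_poly p B w v)\<bar> \<le> c"
      using abs_Re_le_cmod[of "trig_poly p B w v"] norm_trig_poly_le[of p B w v] by (simp add: c_def)
    then show ?thesis
      using c by (auto simp: f_def field_simps abs_le_iff)
  qed
  moreover have "(\<Sum>v\<in>Fp_vec p 2. f v) / real p ^ 2 = 0"
  proof -
    have "complex_of_real (\<Sum>v\<in>Fp_vec p 2. f v) = 0"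
      using sum_trig_poly_eq_0[OF p nz, of B w] by (simp add: f flip: sum_divide_distrib)
    then show ?thesis
      by (simp only: of_real_eq_0_iff)
  qed
  ultimately obtain e where e: "e > 0" "\<And>\<epsilon>. 0 < \<epsilon> \<Longrightarrow> \<epsilon> < e \<Longrightarrow>
      T_forms p 2 D t \<Psi> (\<lambda>x. 1/2 + \<epsilon> * f x) \<ge> (1/2) ^ t"
    using WLS[unfolded weakly_locally_Sidorenko_def, rule_format, of 2 "1/2" f] by auto
  obtain \<eta>\<^sub>0 where \<eta>\<^sub>0: "\<eta>\<^sub>0 > 0" "\<And>\<eta>. 0 < \<eta> \<Longrightarrow> \<eta> < \<eta>\<^sub>0 \<Longrightarrow> X / 2 + \<eta> * Y < 0"
  proof (cases "X < 0")
    case True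
    show ?thesis
    \<comment> \<open>Below this threshold \<open>\<eta> * Y\<close> cannot make up for
      \<open>X / 2\<close>; the added 1 keeps the denominator positive.\<close>
    proof (rule that[of "- X / (2 * (\<bar>Y\<bar> + 1))"])
      show "- X / (2 * (\<bar>Y\<bar> + 1)) > 0"
        using True by (intro divide_pos_pos) auto
      fix \<eta> assume "0 < \<eta>" "\<eta> < - X / (2 * (\<bar>Y\<bar> + 1))"
      then have "\<eta> * (\<bar>Y\<bar> + 1) < - X / 2"
        by (simp add: field_simps)
      moreover have "\<eta> * Y \<le> \<eta> * (\<bar>Y\<bar> + 1)"
        using \<open>0 < \<eta>\<close> by (intro mult_left_mono) auto
      ultimately show "X / 2 + \<eta> * Y < 0"
        by simp
    qed
  next
    case False
    then have "X = 0" "Y < 0"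
      using neg by (auto simp: X_def Y_def)
    then show ?thesis
      by (intro that[of 1]) (auto simp: mult_pos_neg)
  qed
  define \<eta> where "\<eta> = min (e / (2 * c)) \<eta>\<^sub>0 / 2"
  have \<eta>: "\<eta> > 0" "\<eta> < e / (2 * c)" "\<eta> < \<eta>\<^sub>0"
    using e(1) \<eta>\<^sub>0(1) c by (auto simp: \<eta>_def min_def divide_simps)
  \<comment> \<open>This undoes the normalisation of \<open>f\<close>: the perturbation becomes
    \<eta> times the trigonometric polynomial.\<close>
  define \<epsilon> where "\<epsilon> = \<eta> * (2 * c)"
  have \<epsilon>: "\<epsilon> > 0" "\<epsilon> < e"
    using \<eta> c by (simp_all add: \<epsilon>_def field_simps)
  have "complex_of_real (T_forms p 2 D t \<Psi> (\<lambda>x. 1/2 + \<epsilon> * f x)) =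
      T_forms p 2 D t \<Psi> (\<lambda>y. of_real (1/2) + of_real \<eta> * trig_poly p B w y)"
    using c by (simp add: of_real_T_forms f \<epsilon>_def)
  also have "\<dots> = of_real ((1/2) ^ t) + of_real (1/2 * \<eta> ^ (t - 1)) * resonance_sum p D t \<Psi> B w 1 +
      of_real (\<eta> ^ t) * resonance_sum p D t \<Psi> B w 0"
  proof -
    have "T_forms p 2 D t \<Psi> (\<lambda>y. \<alpha> + \<eta> * trig_poly p B w y) =
      \<alpha> ^ t + \<alpha> * \<eta> ^ (t - 1) * resonance_sum p D t \<Psi> B w 1 +
      \<eta> ^ t * resonance_sum p D t \<Psi> B w 0" for \<alpha> \<eta> :: complex
      by (rule T_forms_constant_plus_trig_poly[of p B t w D \<Psi>, OF p B \<open>0 \<notin> B\<close> t w0]) (rule two)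
    then show ?thesis
      by simp
  qed
  finally have "T_forms p 2 D t \<Psi> (\<lambda>x. 1/2 + \<epsilon> * f x) =
      Re (of_real ((1/2) ^ t) + of_real (1/2 * \<eta> ^ (t - 1)) * resonance_sum p D t \<Psi> B w 1 +
      of_real (\<eta> ^ t) * resonance_sum p D t \<Psi> B w 0)"
    by (metis Re_complex_of_real)
  also have "\<dots> = (1/2) ^ t + \<eta> ^ (t - 1) * (X / 2 + \<eta> * Y)"
  proof -
    have "\<eta> ^ t = \<eta> ^ (t - 1) * \<eta>"
      using t by (simp flip: power_Suc2)
    then show ?thesis
      unfolding plus_complex.sel Re_complex_of_real times_complex.sel Im_complex_of_real X_def Y_def
      by (simp add: algebra_simps)
  qed
  also have "\<dots> < (1/2) ^ t"
    using \<eta>\<^sub>0(2)[OF \<eta>(1,3)] \<eta>(1) by (simp add: mult_pos_neg)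
  finally show False
    using e(2)[OF \<epsilon>] by simp
qed

subsection \<open>Two generic equations\<close>

lemma annihilates_lincomb:
  assumes "annihilates p D t \<Psi> g" "annihilates p D t \<Psi> h"
  shows "annihilates p D t \<Psi> (\<lambda>i. a * g i + b * h i)"
proof -
  have "(\<Sum>i<t. (a * g i + b * h i) * \<Psi> i j) = a * (\<Sum>i<t. g i * \<Psi> i j) + b * (\<Sum>i<t. h i * \<Psi> i j)" for j
    by (simp add: sum_distrib_left sum.distrib algebra_simps)
  then show ?thesis
    using assms by (simp add: annihilates_def)
qed

lemma annihilates_cancel:
  assumes "prime p" "\<not> int p dvd a" "annihilates p D t \<Psi> (\<lambda>i. a * g i)"
  shows "annihilates p D t \<Psi> g"
proof -
  have "(\<Sum>i<t. a * g i * \<Psi> i j) = a * (\<Sum>i<t. g i * \<Psi> i j)" for j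
    by (simp add: sum_distrib_left mult.assoc)
  then show ?thesis
    using assms by (auto simp: annihilates_def prime_dvd_mult_iff)
qed

lemma annihilates_cong:
  assumes "\<And>i. i < t \<Longrightarrow> [g i = h i] (mod int p)"
  shows "annihilates p D t \<Psi> g \<longleftrightarrow> annihilates p D t \<Psi> h"
proof -
  have "[(\<Sum>i<t. g i * \<Psi> i j) = (\<Sum>i<t. h i * \<Psi> i j)] (mod int p)" for j
    using assms by (intro cong_sum cong_mult) auto
  then show ?thesis
    unfolding annihilates_def using cong_dvd_iff by blast
qed

lemma num_zeros_eq_1E:
  assumes "num_zeros t b = 1"
  obtains i where "i < t" "b i = 0" "\<And>j. j < t \<Longrightarrow> j \<noteq> i \<Longrightarrow> b j \<noteq> 0"
proof -
  obtain i where i: "{j. j < t \<and> b j = 0} = {i}"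
    using assms by (auto simp: num_zeros_def card_1_singleton_iff)
  show ?thesis
    by (rule that[of i]) (use i in auto)
qed

lemma num_zeros_eq_1I:
  assumes "i < t" "b i = 0" "\<And>j. j < t \<Longrightarrow> j \<noteq> i \<Longrightarrow> b j \<noteq> 0"
  shows "num_zeros t b = 1"
proof -
  have "{j. j < t \<and> b j = 0} = {i}"
    using assms by auto
  then show ?thesis
    by (simp add: num_zeros_def)
qed

text \<open>With weight -1 nothing cancels: the parity of \<open>t - m\<close> alone decides the
  sign, and it only remains to exhibit one resonance.\<close>

lemma resonance_sum_neg_one:
  "resonance_sum p D t \<Psi> B (\<lambda>b. if b = 0 then 1 else - 1) m =
    (- 1) ^ (t - m) * of_nat (card {b \<in> resonances p D t \<Psi> (insert 0 B). num_zeros t b = m})"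
proof -
  have "(\<Prod>i<t. if b i = 0 then 1 else - 1 :: complex) = (- 1) ^ (t - num_zeros t b)" for b
  proof -
    have "{..<t} \<inter> - {i. b i = 0} = {..<t} - {i. i < t \<and> b i = 0}"
      by auto
    moreover have "card ({..<t} - {i. i < t \<and> b i = 0}) = t - num_zeros t b"
      unfolding num_zeros_def by (subst card_Diff_subset) auto
    ultimately show ?thesis
      by (simp add: prod.If_cases)
  qed
  then show ?thesis
    by (simp add: resonance_sum_def)
qed

locale generic_equation_pair =
  fixes p D t :: nat and \<Psi> M :: "nat \<Rightarrow> nat \<Rightarrow> int"
  assumes prime: "prime p"
    and two_le_t: "2 \<le> t"
    and image: "Im_forms p D t \<Psi> = ker_mod p 2 t M"
    and minor: "i < t \<Longrightarrow> j < t \<Longrightarrow> i \<noteq> j \<Longrightarrow> \<not> int p dvd M 0 i * M 1 j - M 0 j * M 1 i"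
begin

lemma p_pos: "p > 0"
  using prime by (rule prime_gt_0_nat)

text \<open>The image is the kernel. Swapping sums gives one direction; evaluating the forms at the
  standard basis vectors recovers their coefficients and gives the other.\<close>

lemma annihilates_iff:
  "annihilates p D t \<Psi> g \<longleftrightarrow> (\<forall>y\<in>ker_mod p 2 t M. int p dvd (\<Sum>i<t. g i * y i))"
proof
  assume ann: "annihilates p D t \<Psi> g"
  show "\<forall>y\<in>ker_mod p 2 t M. int p dvd (\<Sum>i<t. g i * y i)"
  proof
    fix y assume "y \<in> ker_mod p 2 t M"
    then obtain x where y: "y = eval_forms p D t \<Psi> x"
      unfolding image[symmetric] Im_forms_def by blast
    have "[(\<Sum>i<t. g i * y i) = (\<Sum>i<t. g i * (\<Sum>j<D. \<Psi> i j * x j))] (mod int p)"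
      by (intro cong_sum cong_mult cong_refl) (simp add: y eval_forms_def form_def)
    also have "(\<Sum>i<t. g i * (\<Sum>j<D. \<Psi> i j * x j)) = (\<Sum>j<D. (\<Sum>i<t. g i * \<Psi> i j) * x j)"
      unfolding sum_distrib_left sum_distrib_right by (subst sum.swap) (simp add: mult.assoc)
    finally have "[(\<Sum>i<t. g i * y i) = (\<Sum>j<D. (\<Sum>i<t. g i * \<Psi> i j) * x j)] (mod int p)" .
    moreover have "int p dvd (\<Sum>j<D. (\<Sum>i<t. g i * \<Psi> i j) * x j)"
      using ann by (auto simp: annihilates_def intro: dvd_sum[where f = "\<lambda>j. (\<Sum>i<t. g i * \<Psi> i j) * x j"])
    ultimately show "int p dvd (\<Sum>i<t. g i * y i)"
      using cong_dvd_iff by blast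
  qed
next
  assume ker: "\<forall>y\<in>ker_mod p 2 t M. int p dvd (\<Sum>i<t. g i * y i)"
  show "annihilates p D t \<Psi> g"
    unfolding annihilates_def
  proof (intro allI impI)
    fix j assume "j < D"
    define x :: "nat \<Rightarrow> int" where "x = (\<lambda>k\<in>{..<D}. if k = j then 1 else 0)"
    have "x \<in> Fp_vec p D"
      using prime_gt_1_nat[OF prime] by (auto simp: x_def Fp_vec_def Fp_def)
    then have "int p dvd (\<Sum>i<t. g i * eval_forms p D t \<Psi> x i)"
      using ker by (auto simp: image[symmetric] Im_forms_def)
    moreover have "[(\<Sum>i<t. g i * eval_forms p D t \<Psi> x i) = (\<Sum>i<t. g i * \<Psi> i j)] (mod int p)"
    proof (intro cong_sum cong_mult cong_refl)
      fix i assume "i \<in> {..<t}"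
      have "(\<Sum>k<D. \<Psi> i k * x k) = (\<Sum>k<D. if k = j then \<Psi> i k else 0)"
        by (intro sum.cong) (auto simp: x_def)
      then show "[eval_forms p D t \<Psi> x i = \<Psi> i j] (mod int p)"
        using \<open>i \<in> {..<t}\<close> \<open>j < D\<close> by (simp add: eval_forms_def form_def)
    qed
    ultimately show "int p dvd (\<Sum>i<t. g i * \<Psi> i j)"
      using cong_dvd_iff by blast
  qed
qed

lemma annihilates_row: "r < 2 \<Longrightarrow> annihilates p D t \<Psi> (M r)"
  by (simp add: annihilates_iff ker_mod_def cong_0_iff)

text \<open>Cramer's rule: the minor of columns \<open>i\<close> and \<open>j\<close> is invertible
  modulo \<open>p\<close>, so all other coordinates of a kernel vector are free.\<close>

lemma ker_extend:
  fixes y :: "nat \<Rightarrow> int"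
  assumes ij: "i < t" "j < t" "i \<noteq> j"
  obtains z where "z \<in> ker_mod p 2 t M" "\<And>l. l < t \<Longrightarrow> l \<noteq> i \<Longrightarrow> l \<noteq> j \<Longrightarrow> [z l = y l] (mod int p)"
proof -
  define c where "c = M 0 i * M 1 j - M 0 j * M 1 i"
  have "coprime c (int p)"
    using minor[OF ij] prime by (simp add: c_def coprime_commute prime_imp_coprime)
  then obtain d where d: "[c * d = 1] (mod int p)"
    using cong_solve_coprime_int by blast
  define R where "R r = (\<Sum>l\<in>{..<t} - {i, j}. M r l * y l)" for r
  \<comment> \<open>\<open>R r\<close> is what the other columns contribute to equation
    \<open>r\<close>; the entries at \<open>i\<close> and \<open>j\<close> are the Cramer solution
    cancelling it, with \<open>d\<close> the inverse of the minor.\<close>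
  define v where "v l = (if l = i then d * (R 1 * M 0 j - R 0 * M 1 j)
    else if l = j then d * (R 0 * M 1 i - R 1 * M 0 i) else y l)" for l
  define z where "z = (\<lambda>l\<in>{..<t}. v l mod int p)"
  have "z \<in> Fp_vec p t"
    using p_pos by (auto simp: z_def Fp_vec_def Fp_def)
  moreover have "[(\<Sum>l<t. M r l * z l) = 0] (mod int p)" if "r < 2" for r
  proof -
    have "[(\<Sum>l<t. M r l * z l) = (\<Sum>l<t. M r l * v l)] (mod int p)"
      by (intro cong_sum cong_mult cong_refl) (simp add: z_def)
    also have "(\<Sum>l<t. M r l * v l) = M r i * v i + (M r j * v j + (\<Sum>l\<in>{..<t} - {i, j}. M r l * v l))"
    proof -
      have "{..<t} = insert i (insert j ({..<t} - {i, j}))"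
        using ij by auto
      then have "(\<Sum>l<t. M r l * v l) = (\<Sum>l\<in>insert i (insert j ({..<t} - {i, j})). M r l * v l)"
        by simp
      also have "\<dots> = M r i * v i + (M r j * v j + (\<Sum>l\<in>{..<t} - {i, j}. M r l * v l))"
        using ij(3) by simp
      finally show ?thesis .
    qed
    also have "(\<Sum>l\<in>{..<t} - {i, j}. M r l * v l) = R r"
      unfolding R_def by (intro sum.cong) (auto simp: v_def)
    also have "M r i * v i + (M r j * v j + R r) = R r * (1 - c * d)"
    proof -
      have "r = 0 \<or> r = 1"
        using that by auto
      then show ?thesis
        using ij(3) by (auto simp: v_def c_def algebra_simps)
    qed
    also have "[R r * (1 - c * d) = R r * (1 - 1)] (mod int p)"
      by (intro cong_mult cong_diff cong_refl d)
    finally show ?thesis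
      by simp
  qed
  ultimately have "z \<in> ker_mod p 2 t M"
    by (simp add: ker_mod_def)
  then show ?thesis
    by (rule that) (simp add: z_def v_def)
qed

text \<open>Pair \<open>g\<close> with a kernel vector that is 1 at \<open>l\<close> and 0 at every
  other index outside \<open>i\<close> and \<open>j\<close>. Its values at \<open>i\<close> and
  \<open>j\<close> do not matter, since \<open>g\<close> vanishes there, so only \<open>g l\<close>
  is left.\<close>

lemma annihilates_two_zeros:
  assumes g: "annihilates p D t \<Psi> g" and ij: "i < t" "j < t" "i \<noteq> j"
    and dvd: "int p dvd g i" "int p dvd g j" and "l < t"
  shows "int p dvd g l"
proof (cases "l = i \<or> l = j")
  case True
  then show ?thesis
    using dvd by auto
next
  case False
  obtain z where z: "z \<in> ker_mod p 2 t M"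
    "\<And>m. m < t \<Longrightarrow> m \<noteq> i \<Longrightarrow> m \<noteq> j \<Longrightarrow> [z m = (if m = l then 1 else 0)] (mod int p)"
    using ker_extend[OF ij, of "\<lambda>m. if m = l then 1 else 0"] by metis
  have "[g m * z m = (if m = l then g m else 0)] (mod int p)" if "m < t" for m
  proof (cases "m = i \<or> m = j")
    case True
    then have "int p dvd g m * z m" "m \<noteq> l"
      using dvd False by auto
    then show ?thesis
      by (simp add: cong_0_iff)
  next
    case False
    then show ?thesis
      using cong_mult[OF cong_refl[of "g m"] z(2)[OF that]] by (cases "m = l") auto
  qed
  then have "[(\<Sum>m<t. g m * z m) = (\<Sum>m<t. if m = l then g m else 0)] (mod int p)"
    by (intro cong_sum) auto
  moreover have "int p dvd (\<Sum>m<t. g m * z m)"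
    using g z(1) annihilates_iff by blast
  ultimately have "int p dvd (\<Sum>m<t. if m = l then g m else 0)"
    using cong_dvd_iff by blast
  then show ?thesis
    using \<open>l < t\<close> by simp
qed

lemma resonance_two_zeros:
  assumes b: "b \<in> resonances p D t \<Psi> (insert 0 B)" and ij: "i < t" "j < t" "i \<noteq> j"
    and zero: "b i = 0" "b j = 0" and l: "l < t"
    and nz: "\<And>b. b \<in> B \<Longrightarrow> \<not> (int p dvd fst b \<and> int p dvd snd b)"
  shows "b l = 0"
proof -
  have "int p dvd fst (b l)" "int p dvd snd (b l)"
    using annihilates_two_zeros[OF _ ij _ _ l, of "\<lambda>i. fst (b i)"]
      annihilates_two_zeros[OF _ ij _ _ l, of "\<lambda>i. snd (b i)"] b zero
    by (auto simp: resonances_def)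
  moreover have "b l \<in> insert 0 B"
    using b l by (auto simp: resonances_def PiE_def)
  ultimately show ?thesis
    using nz by blast
qed

lemma not_Sidorenko_if_resonance_sum_neg:
  assumes "finite B" "w 0 = 1"
    and "\<And>b. b \<in> B \<Longrightarrow> - b \<in> B" "\<And>b. b \<in> B \<Longrightarrow> w (- b) = cnj (w b)"
    and nz: "\<And>b. b \<in> B \<Longrightarrow> \<not> (int p dvd fst b \<and> int p dvd snd b)"
    and "Re (resonance_sum p D t \<Psi> B w 1) < 0 \<or>
      resonance_sum p D t \<Psi> B w 1 = 0 \<and> Re (resonance_sum p D t \<Psi> B w 0) < 0"
  shows "\<not> weakly_locally_Sidorenko p D t \<Psi>"
  using not_weakly_locally_Sidorenko_if_resonance_sum_neg[of p B t w D \<Psi>, OF p_pos assms(1) two_le_t]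
    assms resonance_two_zeros[OF _ _ _ _ _ _ _ nz]
  by blast

section \<open>The case of even \<open>t\<close>\<close>

lemma not_Sidorenko_even:
  assumes "even t"
  shows "\<not> weakly_locally_Sidorenko p D t \<Psi>"
proof -
  \<comment> \<open>All nonzero residues in one direction, each with two representatives so that the
    set is closed under negation.\<close>
  define B :: "(int \<times> int) set" where "B = (\<lambda>a. (a, 0)) ` {a. \<bar>a\<bar> < int p \<and> a \<noteq> 0}"
  define w :: "int \<times> int \<Rightarrow> complex" where "w = (\<lambda>b. if b = 0 then 1 else - 1)"
  define R where "R = {b \<in> resonances p D t \<Psi> (insert 0 B). num_zeros t b = 1}"
  have fin: "finite B"
    unfolding B_def by (rule finite_imageI, rule finite_subset[of _ "{- int p..int p}"]) auto
  \<comment> \<open>The combination of the rows that eliminates entry 0; its other entries are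
    minors of \<open>M\<close>, hence nonzero modulo \<open>p\<close>.\<close>
  define g where "g j = (M 0 0 * M 1 j + (- M 1 0) * M 0 j) mod int p" for j
  define b :: "nat \<Rightarrow> int \<times> int" where "b = (\<lambda>j\<in>{..<t}. (g j, 0))"
  have g0: "g 0 = 0"
    by (simp add: g_def)
  have g: "g j \<noteq> 0" if "j < t" "j \<noteq> 0" for j
    using minor[of 0 j] that two_le_t by (auto simp: g_def mod_eq_0_iff_dvd algebra_simps)
  have "annihilates p D t \<Psi> (\<lambda>j. M 0 0 * M 1 j + (- M 1 0) * M 0 j)"
    by (intro annihilates_lincomb annihilates_row) auto
  moreover have "annihilates p D t \<Psi> (\<lambda>j. fst (b j)) \<longleftrightarrow>
      annihilates p D t \<Psi> (\<lambda>j. M 0 0 * M 1 j + (- M 1 0) * M 0 j)"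
    by (rule annihilates_cong) (simp add: b_def g_def)
  ultimately have "annihilates p D t \<Psi> (\<lambda>j. fst (b j))"
    by blast
  moreover have "annihilates p D t \<Psi> (\<lambda>j. snd (b j))"
    by (simp add: annihilates_def b_def)
  moreover have "(g j, 0) \<in> insert 0 B" if "j < t" for j
  proof -
    have "\<bar>g j\<bar> < int p"
      using p_pos by (simp add: g_def)
    then show ?thesis
      by (cases "g j = 0") (auto simp: B_def zero_prod_def)
  qed
  then have "b \<in> {..<t} \<rightarrow>\<^sub>E insert 0 B"
    by (auto simp: b_def)
  moreover have "num_zeros t b = 1"
    by (rule num_zeros_eq_1I[of 0]) (use g g0 two_le_t in \<open>auto simp: b_def zero_prod_def\<close>)
  ultimately have "b \<in> R"
    by (simp add: R_def resonances_def)
  moreover have "finite R"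
    using fin by (simp add: R_def finite_resonances)
  ultimately have "card R > 0"
    by (auto simp: card_gt_0_iff)
  moreover have "odd (t - 1)"
    using assms two_le_t by simp
  ultimately have "Re (resonance_sum p D t \<Psi> B w 1) < 0"
    unfolding w_def resonance_sum_neg_one by (simp add: R_def)
  moreover have "\<not> int p dvd a" if "\<bar>a\<bar> < int p" "a \<noteq> 0" for a
    using that zdvd_not_zless[of "\<bar>a\<bar>" "int p"] by auto
  ultimately show ?thesis
    by (intro not_Sidorenko_if_resonance_sum_neg[of B w]) (use fin in \<open>auto simp: w_def B_def\<close>)
qed

section \<open>Additive tuples and resonances of signs\<close>

lemma contains_additive_tuple_if_balanced:
  assumes b: "b \<in> resonances p D t \<Psi> (insert 0 {(1, 0), (- 1, 0)})"
    and one: "num_zeros t b = 1" and sum: "(\<Sum>i<t. fst (b i)) = 0"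
  shows "contains_additive_tuple p D t \<Psi>"
proof -
  obtain i where i: "i < t" "b i = 0" "\<And>j. j < t \<Longrightarrow> j \<noteq> i \<Longrightarrow> b j \<noteq> 0"
    using one by (rule num_zeros_eq_1E) blast
  define s where "s j = fst (b j)" for j
  have ann_s: "annihilates p D t \<Psi> s"
    using b unfolding s_def resonances_def by blast
  define P where "P = {j. j < t \<and> s j = 1}"
  define N where "N = {j. j < t \<and> s j = - 1}"
  define S where "S = {..<t} - {i}"
  have s: "s i = 0" "\<And>j. j \<in> S \<Longrightarrow> s j = 1 \<or> s j = - 1"
    using b i by (auto simp: s_def S_def resonances_def PiE_def Pi_def)
  have S: "S = P \<union> N" "P \<inter> N = {}" "finite P" "finite N"
    using s by (auto simp: P_def N_def S_def)
  have "(\<Sum>j<t. s j) = s i + (\<Sum>j\<in>S. s j)"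
    unfolding S_def using i(1) by (intro sum.remove) auto
  also have "\<dots> = (\<Sum>j\<in>P. s j) + (\<Sum>j\<in>N. s j)"
    using S s by (simp add: sum.union_disjoint)
  also have "\<dots> = int (card P) - int (card N)"
    by (simp add: P_def N_def)
  finally have eq: "card P = card N"
    using sum by (simp add: s_def)
  define m where "m = card P"
  obtain u where u: "bij_betw u {0..<m} P"
    using ex_bij_betw_nat_finite[OF S(3)] m_def by blast
  obtain v where v: "bij_betw v {0..<m} N"
    using ex_bij_betw_nat_finite[OF S(4)] m_def eq by metis
  define k where "k = 2 * m"
  \<comment> \<open>Interleaving the positive and the negative indices makes the signs alternate,
    starting with a plus.\<close>
  define \<sigma> where "\<sigma> l = (if even l then u (l div 2) else v (l div 2))" for l
  have inj_\<sigma>: "inj_on \<sigma> {..<k}"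
  proof (rule inj_onI)
    fix l l' assume l: "l \<in> {..<k}" "l' \<in> {..<k}" "\<sigma> l = \<sigma> l'"
    then have d: "l div 2 < m" "l' div 2 < m"
      by (auto simp: k_def)
    then have mem: "u (l div 2) \<in> P" "u (l' div 2) \<in> P" "v (l div 2) \<in> N" "v (l' div 2) \<in> N"
      using u v by (auto simp: bij_betw_def)
    have par: "even l \<longleftrightarrow> even l'"
      using l(3) mem S(2) by (auto simp: \<sigma>_def split: if_splits)
    have "l div 2 = l' div 2"
    proof (cases "even l")
      case True
      then have "u (l div 2) = u (l' div 2)"
        using l(3) par by (simp add: \<sigma>_def)
      then show ?thesis
        using inj_onD[OF bij_betw_imp_inj_on[OF u]] d by simp
    next
      case False
      then have "v (l div 2) = v (l' div 2)"
        using l(3) par by (simp add: \<sigma>_def)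
      then show ?thesis
        using inj_onD[OF bij_betw_imp_inj_on[OF v]] d by simp
    qed
    then show "l = l'"
      using par by presburger
  qed
  have s_\<sigma>: "\<sigma> l \<in> S" "s (\<sigma> l) = (- 1) ^ l" if "l < k" for l
  proof -
    have "l div 2 < m"
      using that by (auto simp: k_def)
    then have "u (l div 2) \<in> P" "v (l div 2) \<in> N"
      using u v by (auto simp: bij_betw_def)
    then show "\<sigma> l \<in> S" "s (\<sigma> l) = (- 1) ^ l"
      using S(1) by (auto simp: \<sigma>_def P_def N_def)
  qed
  have card_S: "card S = k"
    using S eq by (simp add: card_Un_disjoint m_def k_def)
  then have "card S = card (\<sigma> ` {..<k})"
    by (simp add: card_image inj_\<sigma>)
  moreover have "\<sigma> ` {..<k} \<subseteq> S"
    using s_\<sigma> by auto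
  ultimately have "\<sigma> ` {..<k} = S"
    using S by (metis card_subset_eq finite_Un)
  with inj_\<sigma> have bij: "bij_betw \<sigma> {..<k} S"
    by (simp add: bij_betw_def)
  have k: "k \<ge> 1"
    using card_S i(1) two_le_t by (simp add: S_def)
  have eval: "eval_forms p D k (\<Psi> \<circ> \<sigma>) x l = eval_forms p D t \<Psi> x (\<sigma> l)" if "l < k" for x l
    using s_\<sigma>[OF that] that by (simp add: eval_forms_def S_def)
  \<comment> \<open>Read along \<sigma>, the resonance itself is the alternating equation; the
    missing index \<open>i\<close> has coefficient 0.\<close>
  have alt: "[(\<Sum>l<k. (- 1) ^ l * z (\<sigma> l)) = 0] (mod int p)" if "z \<in> ker_mod p 2 t M" for z
  proof -
    have "(\<Sum>l<k. (- 1) ^ l * z (\<sigma> l)) = (\<Sum>l<k. s (\<sigma> l) * z (\<sigma> l))"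
      using s_\<sigma> by simp
    also have "\<dots> = (\<Sum>j\<in>S. s j * z j)"
      using bij by (rule sum.reindex_bij_betw)
    also have "\<dots> = (\<Sum>j<t. s j * z j)"
      using i(1) s(1) by (subst sum.remove[of "{..<t}" i]) (auto simp: S_def)
    finally show ?thesis
      using ann_s that by (simp add: annihilates_iff cong_0_iff)
  qed
  have "Im_forms p D k (\<Psi> \<circ> \<sigma>) = {y \<in> Fp_vec p k. [(\<Sum>l<k. (- 1) ^ l * y l) = 0] (mod int p)}"
  proof (intro equalityI subsetI)
    fix y assume "y \<in> Im_forms p D k (\<Psi> \<circ> \<sigma>)"
    then obtain x where x: "x \<in> Fp_vec p D" "y = eval_forms p D k (\<Psi> \<circ> \<sigma>) x"
      by (auto simp: Im_forms_def)
    then have "eval_forms p D t \<Psi> x \<in> ker_mod p 2 t M"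
      by (auto simp: image[symmetric] Im_forms_def)
    from alt[OF this] have "[(\<Sum>l<k. (- 1) ^ l * y l) = 0] (mod int p)"
      by (simp add: x(2) eval)
    moreover have "y \<in> Fp_vec p k"
      using p_pos by (auto simp: x(2) eval_forms_def form_def Fp_vec_def Fp_def)
    ultimately show "y \<in> {y \<in> Fp_vec p k. [(\<Sum>l<k. (- 1) ^ l * y l) = 0] (mod int p)}"
      by simp
  next
    fix y assume "y \<in> {y \<in> Fp_vec p k. [(\<Sum>l<k. (- 1) ^ l * y l) = 0] (mod int p)}"
    then have y: "y \<in> Fp_vec p k" "[(\<Sum>l<k. (- 1) ^ l * y l) = 0] (mod int p)"
      by auto
    have j: "\<sigma> 0 < t" "i \<noteq> \<sigma> 0"
      using s_\<sigma>(1)[of 0] k by (auto simp: S_def)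
    \<comment> \<open>For the converse, prescribe every coordinate of \<open>S\<close> except the
      one at \<open>\<sigma> 0\<close>; the two equations are solved for the coordinates at
      \<open>i\<close> and \<open>\<sigma> 0\<close>.\<close>
    obtain z where z: "z \<in> ker_mod p 2 t M" "\<And>l. l < t \<Longrightarrow> l \<noteq> i \<Longrightarrow> l \<noteq> \<sigma> 0 \<Longrightarrow>
        [z l = y (the_inv_into {..<k} \<sigma> l)] (mod int p)"
      using ker_extend[OF i(1) j, of "\<lambda>l. y (the_inv_into {..<k} \<sigma> l)"] by blast
    have c: "[z (\<sigma> l) = y l] (mod int p)" if "l < k" "l \<noteq> 0" for l
    proof -
      have "\<sigma> l \<noteq> \<sigma> 0" "\<sigma> l < t" "\<sigma> l \<noteq> i"
        using inj_onD[OF inj_\<sigma>, of l 0] that k s_\<sigma>(1)[OF that(1)] by (auto simp: S_def)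
      then show ?thesis
        using z(2)[of "\<sigma> l"] that inj_\<sigma> by (simp add: the_inv_into_f_f)
    qed
    \<comment> \<open>Both vectors satisfy the alternating equation and agree off position 0, so
      they agree at position 0 as well.\<close>
    have "[(\<Sum>l<k. (- 1) ^ l * (z (\<sigma> l) - y l)) = 0] (mod int p)"
      using cong_diff[OF alt[OF z(1)] y(2)] by (simp add: right_diff_distrib sum_subtractf)
    moreover have "[(\<Sum>l<k. (- 1) ^ l * (z (\<sigma> l) - y l)) =
        (\<Sum>l<k. if l = 0 then z (\<sigma> l) - y l else 0)] (mod int p)"
      using c by (intro cong_sum) (auto simp: cong_0_iff cong_iff_dvd_diff)
    ultimately have "[(\<Sum>l<k. if l = 0 then z (\<sigma> l) - y l else 0) = 0] (mod int p)"
      using cong_sym cong_trans by blast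
    then have "[z (\<sigma> 0) = y 0] (mod int p)"
      using k by (simp add: cong_0_iff cong_iff_dvd_diff)
    have zy: "z (\<sigma> l) = y l" if "l < k" for l
    proof -
      have "[z (\<sigma> l) = y l] (mod int p)"
        using c[OF that] \<open>[z (\<sigma> 0) = y 0] (mod int p)\<close> by (cases "l = 0") auto
      moreover have "z (\<sigma> l) \<in> Fp p" "y l \<in> Fp p"
        using z(1) y(1) that s_\<sigma>(1)[OF that] by (auto simp: ker_mod_def Fp_vec_def S_def)
      ultimately show ?thesis
        by (simp add: Fp_def cong_def)
    qed
    obtain x where x: "x \<in> Fp_vec p D" "z = eval_forms p D t \<Psi> x"
      using z(1) by (auto simp: image[symmetric] Im_forms_def)
    have "y = eval_forms p D k (\<Psi> \<circ> \<sigma>) x"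
    proof
      fix l
      show "y l = eval_forms p D k (\<Psi> \<circ> \<sigma>) x l"
      proof (cases "l < k")
        case True
        then show ?thesis
          using zy eval x(2) by simp
      next
        case False
        then show ?thesis
          using y(1) by (simp add: eval_forms_def Fp_vec_def PiE_def extensional_def)
      qed
    qed
    then show "y \<in> Im_forms p D k (\<Psi> \<circ> \<sigma>)"
      using x(1) by (auto simp: Im_forms_def)
  qed
  then show ?thesis
    unfolding contains_additive_tuple_def
    by (intro exI[of _ k] exI[of _ S] exI[of _ \<sigma>] conjI) (use k card_S bij in \<open>auto simp: S_def\<close>)
qed

text \<open>The phases \<open>s / t\<close> for \<open>s < t\<close> average the resonance sum to zero, while \<open>s = 0\<close> gives a positive
  value, so some phase gives a negative one.\<close>

lemma not_Sidorenko_unbalanced: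
  assumes no_tuple: "\<not> contains_additive_tuple p D t \<Psi>"
    and b: "b \<in> resonances p D t \<Psi> (insert 0 {(1, 0), (- 1, 0)})" "num_zeros t b = 1"
  shows "\<not> weakly_locally_Sidorenko p D t \<Psi>"
proof -
  define B :: "(int \<times> int) set" where "B = {(1, 0), (- 1, 0)}"
  define R where "R = {b \<in> resonances p D t \<Psi> (insert 0 B). num_zeros t b = 1}"
  define d where "d b = (\<Sum>i<t. fst (b i))" for b :: "nat \<Rightarrow> int \<times> int"
  \<comment> \<open>The frequencies 1 and -1 get opposite phases, so a resonance \<open>b\<close>
    has weight \<open>unit_char t (d b * s)\<close>.\<close>
  define w :: "int \<Rightarrow> int \<times> int \<Rightarrow> complex" where "w s b = unit_char t (fst b * s)" for s b
  define X where "X s = resonance_sum p D t \<Psi> B (w s) 1" for s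
  have fin: "finite R"
    by (simp add: R_def B_def finite_resonances)
  have X: "X s = (\<Sum>b\<in>R. unit_char t (d b * s))" for s
    by (simp add: X_def resonance_sum_def R_def w_def d_def sum_distrib_right flip: unit_char_sum)
  \<comment> \<open>One entry is zero and the others are signs, so \<open>d b\<close> has absolute
    value below \<open>t\<close>; it is nonzero because a balanced resonance yields an additive
    tuple. Hence \<open>t\<close> equally spaced phases suffice for the average to vanish.\<close>
  have d: "\<not> int t dvd d b" if "b \<in> R" for b
  proof -
    obtain i where i: "i < t" "b i = 0"
      using \<open>b \<in> R\<close> num_zeros_eq_1E[of t b] by (auto simp: R_def)
    have "\<bar>fst (b j)\<bar> \<le> 1" if "j < t" for j
    proof -
      have "b j \<in> insert 0 B"
        using \<open>b \<in> R\<close> that by (auto simp: R_def resonances_def PiE_def)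
      then show ?thesis
        by (auto simp: B_def)
    qed
    then have "(\<Sum>j\<in>{..<t} - {i}. \<bar>fst (b j)\<bar>) \<le> (\<Sum>j\<in>{..<t} - {i}. 1)"
      by (intro sum_mono) auto
    then have "(\<Sum>j\<in>{..<t} - {i}. \<bar>fst (b j)\<bar>) < int t"
      using i(1) by simp
    moreover have "d b = (\<Sum>j\<in>{..<t} - {i}. fst (b j))"
      unfolding d_def using i by (subst sum.remove[of _ i]) auto
    then have "\<bar>d b\<bar> \<le> (\<Sum>j\<in>{..<t} - {i}. \<bar>fst (b j)\<bar>)"
      by (metis sum_abs)
    ultimately have "\<bar>d b\<bar> < int t"
      by linarith
    moreover have "d b \<noteq> 0"
      using contains_additive_tuple_if_balanced[of b] no_tuple \<open>b \<in> R\<close>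
      by (auto simp: R_def B_def d_def)
    ultimately show ?thesis
      using zdvd_not_zless[of "\<bar>d b\<bar>" "int t"] by auto
  qed
  have "(\<Sum>s\<in>Fp t. X s) = (\<Sum>b\<in>R. \<Sum>s\<in>Fp t. unit_char t (d b * s))"
    unfolding X by (rule sum.swap)
  also have "\<dots> = 0"
    using two_le_t d by (auto simp: sum_unit_char intro: sum.neutral)
  finally have "(\<Sum>s\<in>Fp t. Re (X s)) = 0"
    by (simp flip: Re_sum)
  moreover have "(\<Sum>s\<in>Fp t. Re (X s)) = Re (X 0) + (\<Sum>s\<in>Fp t - {0}. Re (X s))"
    using two_le_t by (intro sum.remove) (auto simp: Fp_def)
  moreover have "Re (X 0) > 0"
  proof -
    have "b \<in> R"
      using b by (simp add: R_def B_def)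
    then have "card R > 0"
      using fin by (auto simp: card_gt_0_iff)
    then show ?thesis
      by (simp add: X)
  qed
  ultimately have "(\<Sum>s\<in>Fp t - {0}. Re (X s)) < 0"
    by linarith
  then obtain s where s: "Re (X s) < 0"
    by (meson not_le sum_nonneg)
  have "\<not> int p dvd 1"
    using prime_gt_1_nat[OF prime] by simp
  then show ?thesis
    using s by (intro not_Sidorenko_if_resonance_sum_neg[of B "w s"])
      (auto simp: B_def w_def X_def cnj_unit_char)
qed

section \<open>Columns as frequencies and the case of odd \<open>t\<close>\<close>

definition columns :: "(int \<times> int) set" where
  "columns = (\<lambda>j. (M 0 j, M 1 j)) ` {..<t}"

lemma column_nonzero:
  assumes "j < t"
  shows "\<not> (int p dvd M 0 j \<and> int p dvd M 1 j)"
proof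
  assume dvd: "int p dvd M 0 j \<and> int p dvd M 1 j"
  obtain i where "i < t" "i \<noteq> j"
  proof (cases "j = 0")
    case True
    then show ?thesis
      using two_le_t by (intro that[of 1]) auto
  next
    case False
    then show ?thesis
      using two_le_t by (intro that[of 0]) auto
  qed
  then show False
    using minor[of i j] assms dvd by auto
qed

text \<open>In a resonance of columns with one zero all vectors are parallel, hence are the same column up
  to sign; dividing by that column leaves a resonance of signs.\<close>

lemma sign_resonance_if_column_resonance:
  assumes b: "b \<in> resonances p D t \<Psi> (insert 0 (columns \<union> uminus ` columns))"
    and one: "num_zeros t b = 1"
  obtains b' where "b' \<in> resonances p D t \<Psi> (insert 0 {(1, 0), (- 1, 0)})" "num_zeros t b' = 1"
proof -
  obtain i where i: "i < t" "b i = 0" "\<And>j. j < t \<Longrightarrow> j \<noteq> i \<Longrightarrow> b j \<noteq> 0"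
    using one by (rule num_zeros_eq_1E) blast
  define g where "g j = fst (b j)" for j
  define h where "h j = snd (b j)" for j
  have ann: "annihilates p D t \<Psi> g" "annihilates p D t \<Psi> h"
    using b unfolding resonances_def g_def h_def by blast+
  have zero: "g i = 0" "h i = 0"
    using i(2) by (simp_all add: g_def h_def)
  have "\<exists>q e. q < t \<and> (e = 1 \<or> e = - 1) \<and> g j = e * M 0 q \<and> h j = e * M 1 q"
    if "j < t" "j \<noteq> i" for j
  proof -
    have "b j \<in> insert 0 (columns \<union> uminus ` columns)"
      using b that by (auto simp: resonances_def PiE_def)
    then have "b j \<in> columns \<or> b j \<in> uminus ` columns"
      using i(3)[OF that] by auto
    then show ?thesis
    proof
      assume "b j \<in> columns"
      then obtain q where "q < t" "b j = (M 0 q, M 1 q)"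
        by (auto simp: columns_def)
      then show ?thesis
        by (intro exI[of _ q] exI[of _ 1]) (simp add: g_def h_def)
    next
      assume "b j \<in> uminus ` columns"
      then obtain q where "q < t" "b j = - (M 0 q, M 1 q)"
        by (auto simp: columns_def)
      then show ?thesis
        by (intro exI[of _ q] exI[of _ "- 1"]) (simp add: g_def h_def)
    qed
  qed
  then obtain q e where "\<And>j. j < t \<Longrightarrow> j \<noteq> i \<Longrightarrow>
      q j < t \<and> (e j = 1 \<or> e j = - 1) \<and> g j = e j * M 0 (q j) \<and> h j = e j * M 1 (q j)"
    by metis
  then have qe: "\<And>j. j < t \<Longrightarrow> j \<noteq> i \<Longrightarrow> q j < t"
    "\<And>j. j < t \<Longrightarrow> j \<noteq> i \<Longrightarrow> e j = 1 \<or> e j = - 1"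
    "\<And>j. j < t \<Longrightarrow> j \<noteq> i \<Longrightarrow> g j = e j * M 0 (q j)"
    "\<And>j. j < t \<Longrightarrow> j \<noteq> i \<Longrightarrow> h j = e j * M 1 (q j)"
    by blast+
  obtain k where k: "k < t" "k \<noteq> i"
  proof (cases "i = 0")
    case True
    then show ?thesis
      using two_le_t by (intro that[of 1]) auto
  next
    case False
    then show ?thesis
      using two_le_t by (intro that[of 0]) auto
  qed
  have q: "q j = q k" if j: "j < t" "j \<noteq> i" for j
  proof (rule ccontr)
    assume "q j \<noteq> q k"
    \<comment> \<open>This combination vanishes at \<open>i\<close> and at \<open>k\<close>, hence
      everywhere. Its value at \<open>j\<close> is, up to sign, the minor of columns
      \<open>q k\<close> and \<open>q j\<close>, which genericity makes nonzero.\<close>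
    have "annihilates p D t \<Psi> (\<lambda>l. g k * h l + (- h k) * g l)"
      using ann by (intro annihilates_lincomb)
    then have "int p dvd g k * h j + (- h k) * g j"
      by (rule annihilates_two_zeros[where i = i and j = k]) (use i k j zero in auto)
    then have "int p dvd e k * e j * (M 0 (q k) * M 1 (q j) - M 0 (q j) * M 1 (q k))"
      using qe(3,4) j k by (simp add: algebra_simps)
    then have "int p dvd M 0 (q k) * M 1 (q j) - M 0 (q j) * M 1 (q k)"
      using qe(2)[OF j] qe(2)[OF k] by (auto simp: dvd_diff_commute)
    then show False
      using minor[of "q k" "q j"] qe(1)[OF j] qe(1)[OF k] \<open>q j \<noteq> q k\<close> by auto
  qed
  define e' where "e' j = (if j = i then 0 else e j)" for j
  have gh: "g j = M 0 (q k) * e' j" "h j = M 1 (q k) * e' j" if "j < t" for j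
    using qe(3,4) q zero that by (auto simp: e'_def)
  have "annihilates p D t \<Psi> (\<lambda>j. M 0 (q k) * e' j)" "annihilates p D t \<Psi> (\<lambda>j. M 1 (q k) * e' j)"
    using ann annihilates_cong[of t g "\<lambda>j. M 0 (q k) * e' j" p D \<Psi>]
      annihilates_cong[of t h "\<lambda>j. M 1 (q k) * e' j" p D \<Psi>] gh by simp_all
  \<comment> \<open>At least one coordinate of the common column is invertible modulo
    \<open>p\<close> and can be cancelled.\<close>
  then have ann_e: "annihilates p D t \<Psi> e'"
    using column_nonzero[OF qe(1)[OF k]] annihilates_cancel[OF prime] by blast
  define b' :: "nat \<Rightarrow> int \<times> int" where "b' = (\<lambda>j\<in>{..<t}. (e' j, 0))"
  have "annihilates p D t \<Psi> (\<lambda>j. fst (b' j))"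
    using ann_e annihilates_cong[of t "\<lambda>j. fst (b' j)" e' p D \<Psi>] by (simp add: b'_def)
  moreover have "annihilates p D t \<Psi> (\<lambda>j. snd (b' j))"
    by (simp add: annihilates_def b'_def)
  moreover have "b' \<in> {..<t} \<rightarrow>\<^sub>E insert 0 {(1, 0), (- 1, 0)}"
    using qe(2) by (auto simp: b'_def e'_def zero_prod_def)
  ultimately have "b' \<in> resonances p D t \<Psi> (insert 0 {(1, 0), (- 1, 0)})"
    by (simp add: resonances_def)
  moreover have "num_zeros t b' = 1"
    by (rule num_zeros_eq_1I[OF i(1)]) (use i(1) qe(2) in \<open>force simp: b'_def e'_def zero_prod_def\<close>)+
  ultimately show ?thesis
    by (rule that)
qed

text \<open>If signs form a resonance with one zero, the averaging over phases applies. If not,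
  neither do signed columns, so the term with one factor \<alpha> drops out and the next one
  decides.\<close>

lemma not_Sidorenko_odd:
  assumes t: "odd t" and no_tuple: "\<not> contains_additive_tuple p D t \<Psi>"
  shows "\<not> weakly_locally_Sidorenko p D t \<Psi>"
proof (cases "\<exists>b\<in>resonances p D t \<Psi> (insert 0 {(1, 0), (- 1, 0)}). num_zeros t b = 1")
  case True
  then show ?thesis
    using not_Sidorenko_unbalanced[OF no_tuple] by blast
next
  case False
  define B where "B = columns \<union> uminus ` columns"
  define w :: "int \<times> int \<Rightarrow> complex" where "w = (\<lambda>b. if b = 0 then 1 else - 1)"
  define R where "R m = {b \<in> resonances p D t \<Psi> (insert 0 B). num_zeros t b = m}" for m
  \<comment> \<open>The columns in their own order: the two components are the rows of
    \<open>M\<close>, which annihilate the image, and no entry is zero.\<close>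
  define b :: "nat \<Rightarrow> int \<times> int" where "b = (\<lambda>j\<in>{..<t}. (M 0 j, M 1 j))"
  have fin: "finite B"
    by (simp add: B_def columns_def)
  have nz: "\<not> (int p dvd fst c \<and> int p dvd snd c)" if "c \<in> B" for c
    using that column_nonzero by (auto simp: B_def columns_def)
  have "R 1 = {}"
    using False sign_resonance_if_column_resonance unfolding R_def B_def by blast
  moreover have "resonance_sum p D t \<Psi> B w m = (- 1) ^ (t - m) * of_nat (card (R m))" for m
    unfolding w_def R_def by (rule resonance_sum_neg_one)
  moreover have "card (R 0) > 0"
  proof -
    have "annihilates p D t \<Psi> (\<lambda>j. fst (b j))" "annihilates p D t \<Psi> (\<lambda>j. snd (b j))"
      using annihilates_row annihilates_cong[of t "\<lambda>j. fst (b j)" "M 0" p D \<Psi>]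
        annihilates_cong[of t "\<lambda>j. snd (b j)" "M 1" p D \<Psi>] by (simp_all add: b_def)
    moreover have "b \<in> {..<t} \<rightarrow>\<^sub>E insert 0 B"
      by (auto simp: b_def B_def columns_def)
    moreover have "b j \<noteq> 0" if "j < t" for j
      using column_nonzero[OF that] that by (auto simp: b_def zero_prod_def)
    then have "num_zeros t b = 0"
      by (auto simp: num_zeros_def)
    ultimately have "b \<in> R 0"
      by (simp add: R_def resonances_def)
    moreover have "finite (R 0)"
      using fin by (simp add: R_def finite_resonances)
    ultimately show ?thesis
      by (auto simp: card_gt_0_iff)
  qed
  ultimately have "resonance_sum p D t \<Psi> B w 1 = 0" "Re (resonance_sum p D t \<Psi> B w 0) < 0"
    using t by simp_all
  moreover have "0 \<notin> B"
    using nz[of 0] by auto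
  moreover have "- c \<in> B" if "c \<in> B" for c
    using that by (auto simp: B_def)
  ultimately show ?thesis
    by (intro not_Sidorenko_if_resonance_sum_neg[of B w]) (use fin nz in \<open>auto simp: w_def\<close>)
qed

end

section \<open>Rank two and the conclusion\<close>

lemma two_le_if_rank_mod_eq_2:
  assumes "prime p" and "rank_mod p 2 t M = 2"
  shows "t \<ge> 2"
proof (rule ccontr)
  assume "\<not> t \<ge> 2"
  define indep where "indep I \<longleftrightarrow> (\<forall>c :: nat \<Rightarrow> int.
    (\<forall>j<t. [(\<Sum>r\<in>I. c r * M r j) = 0] (mod int p)) \<longrightarrow> (\<forall>r\<in>I. [c r = 0] (mod int p)))" for I :: "nat set"
  define C where "C = {card I | I. I \<subseteq> {..<2} \<and> indep I}"
  have "finite C"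
    unfolding C_def by (rule finite_subset[of _ "card ` Pow {..<2}"]) auto
  \<comment> \<open>The empty family of rows is independent, so the maximum is taken over a nonempty
    set and is attained.\<close>
  moreover have "card {} \<in> C"
    unfolding C_def by (rule CollectI) (auto simp: indep_def intro: exI[of _ "{}"])
  ultimately have "Max C \<in> C"
    by (intro Max_in) auto
  then have "2 \<in> C"
    using assms(2) by (simp add: rank_mod_def C_def indep_def)
  then obtain I where I: "I \<subseteq> {..<2}" "indep I" "card I = 2"
    by (auto simp: C_def)
  have "I = {..<2}"
    using I(1,3) by (intro card_subset_eq) auto
  then have indep: "[c 0 = 0] (mod int p) \<and> [c 1 = 0] (mod int p)"
    if "\<And>j. j < t \<Longrightarrow> [c 0 * M 0 j + c 1 * M 1 j = 0] (mod int p)" for c :: "nat \<Rightarrow> int"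
    using I(2) that by (auto simp: indep_def numeral_2_eq_2 lessThan_Suc add.commute)
  have j0: "j = 0" if "j < t" for j
    using that \<open>\<not> t \<ge> 2\<close> by simp
  have zero: "int p dvd M r 0" if "t > 0" "r < 2" for r
  proof -
    \<comment> \<open>With a single column these coefficients give a relation between the two rows,
      so independence makes both entries vanish modulo \<open>p\<close>.\<close>
    define c where "c i = (if i = 0 then M 1 0 else - M 0 0)" for i :: nat
    have "[c 0 = 0] (mod int p) \<and> [c 1 = 0] (mod int p)"
    proof (rule indep)
      fix j assume "j < t"
      then show "[c 0 * M 0 j + c 1 * M 1 j = 0] (mod int p)"
        using j0[of j] by (simp add: c_def)
    qed
    then show ?thesis
      using that(2) by (auto simp: c_def cong_0_iff less_2_cases_iff)
  qed
  \<comment> \<open>All entries are now zero modulo \<open>p\<close>, or there is no column at all;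
    either way the coefficients 1 and 1 contradict independence.\<close>
  have "[1 = 0] (mod int p) \<and> [1 = 0] (mod int p)"
  proof (rule indep[of "\<lambda>_. 1"])
    fix j assume "j < t"
    then show "[1 * M 0 j + 1 * M 1 j = 0] (mod int p)"
      using zero[of 0] zero[of 1] j0[of j] by (auto simp: cong_0_iff)
  qed
  then show False
    using assms(1) by (auto simp: cong_0_iff prime_gt_1_nat)
qed

theorem theorem3p1:
  fixes t :: nat
  shows "\<exists>p\<^sub>0 :: nat. \<forall>(p :: nat) (D :: nat) (\<Psi> :: nat \<Rightarrow> nat \<Rightarrow> int) (M :: nat \<Rightarrow> nat \<Rightarrow> int).
    prime p \<longrightarrow>
    linear_system p D t \<Psi> \<longrightarrow>
    rank_mod p 2 t M = 2 \<longrightarrow>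
    Im_forms p D t \<Psi> = ker_mod p 2 t M \<longrightarrow>
    linearly_generic p t M \<longrightarrow>
    even t \<or> (\<not> contains_additive_tuple p D t \<Psi> \<and> p \<ge> p\<^sub>0) \<longrightarrow>
    \<not> weakly_locally_Sidorenko p D t \<Psi>"
proof (intro exI[of _ 0] allI impI)
  fix p D :: nat and \<Psi> M :: "nat \<Rightarrow> nat \<Rightarrow> int"
  assume hyps: "prime p" "rank_mod p 2 t M = 2" "Im_forms p D t \<Psi> = ker_mod p 2 t M"
    and generic: "linearly_generic p t M"
    and t: "even t \<or> (\<not> contains_additive_tuple p D t \<Psi> \<and> p \<ge> 0)"
  \<comment> \<open>Genericity speaks of \<open>i < j\<close> only; exchanging two columns changes
    the sign of the minor.\<close>
  have minor: "\<not> int p dvd M 0 i * M 1 j - M 0 j * M 1 i" if "i < t" "j < t" "i \<noteq> j" for i j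
  proof (cases "i < j")
    case True
    then show ?thesis
      using generic that by (simp add: linearly_generic_def cong_0_iff)
  next
    case False
    then have "\<not> int p dvd M 0 j * M 1 i - M 0 i * M 1 j"
      using generic that by (simp add: linearly_generic_def cong_0_iff)
    then show ?thesis
      by (simp add: dvd_diff_commute)
  qed
  interpret generic_equation_pair p D t \<Psi> M
    using hyps minor two_le_if_rank_mod_eq_2 by unfold_locales auto
  show "\<not> weakly_locally_Sidorenko p D t \<Psi>"
    using t not_Sidorenko_even not_Sidorenko_odd by blast
qed

end
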